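(* For every real $R\ge 1$, there is no constant competitive deterministic online algorithm for the general\&non-removable online knapsack problem with a buffer of capacity $R$; that is, for every deterministic online algorithm $\mathrm{ALG}$ and every real $c$, there is an input sequence $I$ with $\mathrm{OPT}(I)> c\cdot\mathrm{ALG}(I)$.
   Context: Online knapsack problem with a resource buffer: there is a knapsack of capacity $1$ and a buffer of capacity $R\ge 1$. Items $e_1,\dots,e_n$ arrive one by one; each item $e$ has size $s(e)$ with $0<s(e)\le 1$ and value $v(e)\ge 0$; for a set $B$ write $s(B)=\sum_{e\in B}s(e)$, $v(B)=\sum_{e\in B}v(e)$. A deterministic online algorithm maintains buffer contents $B_0=\emptyset,B_1,\dots,B_n$, where $B_i$ is chosen after seeing $e_1,\dots,e_i$ (without knowledge of future items), with $B_i\subseteq B_{i-1}\cup\{e_i\}$ and $s(B_i)\le R$. In the non-removable setting additionally $B_{i-1}\subseteq B_i$. The algorithm's value is $\mathrm{ALG}(I)=\max\{v(B)\mid B\subseteq B_n,\ s(B)\le 1\}$ and $\mathrm{OPT}(I)=\max\{v(B)\mid B\subseteq\{e_1,\dots,e_n\},\ s(B)\le 1\}$. "General" means values are arbitrary. An algorithm is $c$-competitive if $\mathrm{OPT}(I)\le c\cdot \mathrm{ALG}(I)$ for every input $I$. *)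

theory Defs
  imports Complex_Main
begin

datatype item = Item (item_size: real) (item_value: real)

text \<open>
  An input is a list of items in order of arrival.  Sets of items are represented by sets of
  positions in that list (counting from 0), so that distinct items may have equal size and value.
\<close>

definition valid_input :: "item list \<Rightarrow> bool" where
  "valid_input I \<longleftrightarrow> (\<forall>e\<in>set I. 0 < item_size e \<and> item_size e \<le> 1 \<and> 0 \<le> item_value e)"

definition total_size :: "item list \<Rightarrow> nat set \<Rightarrow> real" where
  "total_size I B = (\<Sum>i\<in>B. item_size (I ! i))"

definition total_value :: "item list \<Rightarrow> nat set \<Rightarrow> real" where
  "total_value I B = (\<Sum>i\<in>B. item_value (I ! i))"

definition knapsack_value :: "item list \<Rightarrow> nat set \<Rightarrow> real" where
  "knapsack_value I S = Max {total_value I B | B. B \<subseteq> S \<and> total_size I B \<le> 1}"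

definition opt_value :: "item list \<Rightarrow> real" where
  "opt_value I = knapsack_value I {..<length I}"

text \<open>
  A deterministic online algorithm maps the items seen so far to the current buffer contents.
  On input \<open>I\<close> the buffer after the first \<open>i\<close> arrivals is \<open>A (take i I)\<close>; the item arriving
  next is the one at position \<open>i\<close>.
\<close>

definition online_algorithm :: "real \<Rightarrow> (item list \<Rightarrow> nat set) \<Rightarrow> bool" where
  "online_algorithm R A \<longleftrightarrow>
     A [] = {} \<and>
     (\<forall>I. valid_input I \<longrightarrow>
        (\<forall>i<length I. A (take (Suc i) I) \<subseteq> A (take i I) \<union> {i} \<and>
                      total_size I (A (take (Suc i) I)) \<le> R))"

definition non_removable :: "(item list \<Rightarrow> nat set) \<Rightarrow> bool" where
  "non_removable A \<longleftrightarrow>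
     (\<forall>I. valid_input I \<longrightarrow> (\<forall>i<length I. A (take i I) \<subseteq> A (take (Suc i) I)))"

definition alg_value :: "(item list \<Rightarrow> nat set) \<Rightarrow> item list \<Rightarrow> real" where
  "alg_value A I = knapsack_value I (A I)"

definition competitive :: "real \<Rightarrow> (item list \<Rightarrow> nat set) \<Rightarrow> bool" where
  "competitive c A \<longleftrightarrow> (\<forall>I. valid_input I \<longrightarrow> opt_value I \<le> c * alg_value A I)"

lemma not_competitive_iff:
  "\<not> competitive c A \<longleftrightarrow> (\<exists>I. valid_input I \<and> opt_value I > c * alg_value A I)"
  by (auto simp: competitive_def not_le)

end

theory Submission
  imports Defs
begin

text \<open>
  Feed the algorithm items of size 1 whose values are powers of some \<open>M > max c 1\<close>. A
  \<open>c\<close>-competitive algorithm must keep every arriving item, since otherwise its best choice is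
  worth at most a fraction \<open>1 / M\<close> of the rejected item. As nothing can be removed, the buffer
  overflows after more than \<open>R\<close> items.
\<close>

text \<open>\<open>Max\<close> is meaningful only on finite nonempty sets. Finiteness here supports
  the two facts through which \<open>knapsack_value\<close> is used: it bounds every feasible
  packing and is attained by one.\<close>

lemma finite_knapsack_values:
  assumes "finite S"
  shows "finite {total_value I B | B. B \<subseteq> S \<and> total_size I B \<le> 1}"
proof (rule finite_subset)
  show "{total_value I B | B. B \<subseteq> S \<and> total_size I B \<le> 1} \<subseteq> total_value I ` Pow S"
    by auto
qed (use assms in simp)

lemma knapsack_value_ge:
  assumes "finite S" "B \<subseteq> S" "total_size I B \<le> 1"
  shows "total_value I B \<le> knapsack_value I S"
  unfolding knapsack_value_def
  by (rule Max_ge[OF finite_knapsack_values[OF assms(1)]]) (use assms in auto)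

lemma knapsack_value_attained:
  assumes "finite S"
  obtains B where "B \<subseteq> S" "total_size I B \<le> 1" "knapsack_value I S = total_value I B"
proof -
  let ?V = "{total_value I B | B. B \<subseteq> S \<and> total_size I B \<le> 1}"
  have "total_size I {} \<le> 1"
    by (simp add: total_size_def)
  then have "?V \<noteq> {}"
    by blast
  then have "Max ?V \<in> ?V"
    by (rule Max_in[OF finite_knapsack_values[OF assms]])
  then show thesis
    using that by (auto simp: knapsack_value_def)
qed

text \<open>Unit sizes let at most one item into the knapsack. Shorter inputs are prefixes of longer
  ones, so a single run of the algorithm can be followed by induction on the length.\<close>

definition power_items :: "real \<Rightarrow> nat \<Rightarrow> item list" where
  "power_items M n = map (\<lambda>i. Item 1 (M ^ i)) [0..<n]"

lemma length_power_items [simp]: "length (power_items M n) = n"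
  by (simp add: power_items_def)

lemma nth_power_items [simp]: "i < n \<Longrightarrow> power_items M n ! i = Item 1 (M ^ i)"
  by (simp add: power_items_def)

lemma take_power_items [simp]: "k \<le> n \<Longrightarrow> take k (power_items M n) = power_items M k"
  by (simp add: power_items_def take_map)

lemma valid_power_items: "0 \<le> M \<Longrightarrow> valid_input (power_items M n)"
  by (auto simp: valid_input_def power_items_def)

lemma total_size_power_items:
  assumes "B \<subseteq> {..<n}"
  shows "total_size (power_items M n) B = card B"
proof -
  have "total_size (power_items M n) B = (\<Sum>i\<in>B. 1)"
    unfolding total_size_def by (rule sum.cong) (use assms in auto)
  then show ?thesis by simp
qed

lemma opt_value_power_items_ge: "M ^ n \<le> opt_value (power_items M (Suc n))"
proof -
  have "total_value (power_items M (Suc n)) {n} \<le> opt_value (power_items M (Suc n))"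
    unfolding opt_value_def
    by (rule knapsack_value_ge) (auto simp: total_size_power_items)
  then show ?thesis
    by (simp add: total_value_def)
qed

text \<open>This is the situation after rejecting the newest item \<open>n\<close>: a feasible
  packing is empty or a single older item, worth at most \<open>M ^ (n - 1)\<close>, and
  \<open>c < M\<close> leaves a gap to \<open>M ^ n\<close>.\<close>

lemma knapsack_value_power_items_less:
  assumes "1 < M" "c < M"
  shows "c * knapsack_value (power_items M (Suc n)) {..<n} < M ^ n"
proof -
  obtain B where B: "B \<subseteq> {..<n}" "total_size (power_items M (Suc n)) B \<le> 1"
    and v: "knapsack_value (power_items M (Suc n)) {..<n} = total_value (power_items M (Suc n)) B"
    by (rule knapsack_value_attained[of "{..<n}"]) auto
  have "finite B"
    using B(1) finite_subset by blast
  have "B \<subseteq> {..<Suc n}"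
    using B(1) by auto
  then have "card B \<le> 1"
    using B(2) by (simp add: total_size_power_items)
  then consider "B = {}" | i where "B = {i}"
    using \<open>finite B\<close> by (metis card_1_singletonE card_0_eq le_Suc_eq le_zero_eq One_nat_def)
  then show ?thesis
  proof cases
    \<comment> \<open>The packing has value 0 while \<open>M ^ n\<close> is positive; for
      \<open>n = 0\<close> this is the only case.\<close>
    case 1
    then show ?thesis
      using assms v by (simp add: total_value_def)
  next
    case 2
    then have "i < n"
      using B(1) by simp
    have "c * M ^ i < M * M ^ i"
      using assms by simp
    also have "\<dots> = M ^ Suc i"
      by simp
    also have "\<dots> \<le> M ^ n"
      using assms(1) \<open>i < n\<close> by (intro power_increasing) auto
    finally show ?thesis
      using 2 v \<open>i < n\<close> by (simp add: total_value_def)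
  qed
qed

text \<open>By induction, the buffer after item \<open>n\<close> arrives is either
  \<open>{..<n}\<close> or \<open>{..<Suc n}\<close>; the former would violate competitiveness on
  this very prefix.\<close>

lemma competitive_keeps_all:
  assumes "online_algorithm R A" "non_removable A" "competitive c A" "1 < M" "c < M"
  shows "A (power_items M n) = {..<n}"
proof (induction n)
  case 0
  then show ?case
    using assms(1) by (simp add: online_algorithm_def power_items_def)
next
  case (Suc n)
  let ?I = "power_items M (Suc n)"
  have valid: "valid_input ?I"
    using assms(4) by (intro valid_power_items) simp
  have "A (take (Suc n) ?I) \<subseteq> A (take n ?I) \<union> {n}"
    using assms(1) valid unfolding online_algorithm_def by (metis length_power_items lessI)
  moreover have "A (take n ?I) \<subseteq> A (take (Suc n) ?I)"
    using assms(2) valid unfolding non_removable_def by (metis length_power_items lessI)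
  ultimately have bounds: "A ?I \<subseteq> {..<n} \<union> {n}" "{..<n} \<subseteq> A ?I"
    using Suc.IH by simp_all
  have "n \<in> A ?I"
  proof (rule ccontr)
    assume "n \<notin> A ?I"
    then have "A ?I = {..<n}"
      using bounds by auto
    then have "c * alg_value A ?I < M ^ n"
      using knapsack_value_power_items_less[OF assms(4,5)] by (simp add: alg_value_def)
    also have "\<dots> \<le> opt_value ?I"
      by (rule opt_value_power_items_ge)
    finally show False
      using assms(3) valid by (simp add: competitive_def not_le[symmetric])
  qed
  with bounds show ?case
    by (auto simp: lessThan_Suc)
qed

lemma not_competitive:
  assumes "online_algorithm R A" "non_removable A"
  shows "\<not> competitive c A"
proof
  assume comp: "competitive c A"
  \<comment> \<open>Here \<open>c\<close> is an arbitrary real, possibly negative; the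
    \<open>max\<close> ensures that the powers of \<open>M\<close> grow as well.\<close>
  define M where "M = max c 1 + 1"
  have M: "1 < M" "c < M"
    by (auto simp: M_def)
  obtain n where n: "R < real n"
    using reals_Archimedean2 by blast
  \<comment> \<open>The capacity bound is stated only after an arrival, hence the length
    \<open>Suc n\<close>: the buffer then has size \<open>n + 1 > R\<close>.\<close>
  let ?I = "power_items M (Suc n)"
  have "valid_input ?I"
    using M(1) by (intro valid_power_items) simp
  then have "total_size ?I (A (take (Suc n) ?I)) \<le> R"
    using assms(1) unfolding online_algorithm_def by (metis length_power_items lessI)
  then show False
    using n competitive_keeps_all[OF assms comp M, of "Suc n"]
    by (simp add: total_size_power_items)
qed

theorem theorem1:
  fixes R :: real
  assumes "R \<ge> 1"
  shows "\<forall>A. online_algorithm R A \<and> non_removable A \<longrightarrow>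
           (\<forall>c::real. \<exists>I. valid_input I \<and> opt_value I > c * alg_value A I)"
  using not_competitive unfolding not_competitive_iff by blast

end
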